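(* Suppose that $G$ is a hereditarily just-infinite group and has property (PF). Then $G$ has no continuous URS.
   Context: A group $G$ is just-infinite if $G$ is infinite and $G/N$ is finite for every non-trivial normal subgroup $N$ of $G$; $G$ is hereditarily just-infinite if every finite index subgroup of $G$ is just-infinite. A subgroup $H$ of $G$ is co-finitely dense for the profinite topology if its closure in the profinite topology on $G$, namely $\bigcap_N HN$ over all finite index normal subgroups $N$ of $G$, has finite index in $G$. $G$ has property (PF) if every subgroup of $G$ that is co-finitely dense for the profinite topology has finite index in $G$. $\mathrm{Sub}(G)$ is the set of subgroups of $G$ with the topology induced from the product topology on $\{0,1\}^G$, on which $G$ acts by conjugation. A URS of $G$ is a non-empty closed $G$-invariant minimal subset of $\mathrm{Sub}(G)$. A URS is continuous if it is not a finite set. *)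

theory Defs
  imports "HOL-Analysis.Analysis" "HOL-Algebra.Coset"
begin

definition finite_index :: "('a, 'b) monoid_scheme \<Rightarrow> 'a set \<Rightarrow> bool" where
  "finite_index G H \<longleftrightarrow> subgroup H G \<and> finite (rcosets\<^bsub>G\<^esub> H)"

definition just_infinite :: "('a, 'b) monoid_scheme \<Rightarrow> bool" where
  "just_infinite G \<longleftrightarrow>
     infinite (carrier G) \<and>
     (\<forall>N. N \<lhd> G \<and> N \<noteq> {\<one>\<^bsub>G\<^esub>} \<longrightarrow> finite (carrier (G Mod N)))"

definition hereditarily_just_infinite :: "('a, 'b) monoid_scheme \<Rightarrow> bool" where
  "hereditarily_just_infinite G \<longleftrightarrow>
     (\<forall>H. finite_index G H \<longrightarrow> just_infinite (G\<lparr>carrier := H\<rparr>))"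

text \<open>The intersection is over a non-empty family, since the carrier is itself a normal
  subgroup of finite index; so the closure is a subset of the carrier.\<close>

definition profinite_closure :: "('a, 'b) monoid_scheme \<Rightarrow> 'a set \<Rightarrow> 'a set" where
  "profinite_closure G H = (\<Inter>N \<in> {N. N \<lhd> G \<and> finite_index G N}. H <#>\<^bsub>G\<^esub> N)"

definition cofinitely_dense :: "('a, 'b) monoid_scheme \<Rightarrow> 'a set \<Rightarrow> bool" where
  "cofinitely_dense G H \<longleftrightarrow> subgroup H G \<and> finite_index G (profinite_closure G H)"

definition property_PF :: "('a, 'b) monoid_scheme \<Rightarrow> bool" where
  "property_PF G \<longleftrightarrow> (\<forall>H. cofinitely_dense G H \<longrightarrow> finite_index G H)"

text \<open>A subgroup is identified with its indicator function on the carrier; \<^typ>\<open>bool\<close>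
  with the discrete topology plays the role of \<open>{0,1}\<close>. The pullback along the
  indicator map is the topology induced from the product topology.\<close>

definition Sub_topology :: "('a, 'b) monoid_scheme \<Rightarrow> 'a set topology" where
  "Sub_topology G =
     pullback_topology {H. subgroup H G} (\<lambda>H. \<lambda>x\<in>carrier G. x \<in> H)
       (product_topology (\<lambda>_. discrete_topology (UNIV :: bool set)) (carrier G))"

definition conj_invariant :: "('a, 'b) monoid_scheme \<Rightarrow> 'a set set \<Rightarrow> bool" where
  "conj_invariant G \<U> \<longleftrightarrow>
     (\<forall>g \<in> carrier G. \<forall>H \<in> \<U>. g <#\<^bsub>G\<^esub> H #>\<^bsub>G\<^esub> (inv\<^bsub>G\<^esub> g) \<in> \<U>)"

definition URS :: "('a, 'b) monoid_scheme \<Rightarrow> 'a set set \<Rightarrow> bool" where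
  "URS G \<U> \<longleftrightarrow>
     \<U> \<noteq> {} \<and> closedin (Sub_topology G) \<U> \<and> conj_invariant G \<U> \<and>
     (\<forall>\<V>. \<V> \<subseteq> \<U> \<and> \<V> \<noteq> {} \<and> closedin (Sub_topology G) \<V> \<and> conj_invariant G \<V> \<longrightarrow> \<V> = \<U>)"

definition continuous_URS :: "('a, 'b) monoid_scheme \<Rightarrow> 'a set set \<Rightarrow> bool" where
  "continuous_URS G \<U> \<longleftrightarrow> URS G \<U> \<and> infinite \<U>"

lemma topspace_Sub_topology: "topspace (Sub_topology G) = {H. subgroup H G}"
  unfolding Sub_topology_def topspace_pullback_topology by auto

end

theory Submission
  imports Defs "HOL-Algebra.Zassenhaus"
begin

text \<open>Suppose that \<open>\<U>\<close> is a continuous URS and let \<open>H\<close> be one of its members. The trivial subgroup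
  is a fixed point of conjugation, so by minimality it cannot lie in the infinite set \<open>\<U>\<close>. As \<open>\<U>\<close>
  is closed, a whole basic neighbourhood of the trivial subgroup misses \<open>\<U>\<close>, which says that some
  finite set \<open>P\<close> of non-trivial elements meets every member of \<open>\<U>\<close>, and in particular every
  conjugate of \<open>H\<close>: the subgroup \<open>H\<close> is confined.

  Write \<open>C\<close> for the profinite closure of \<open>H\<close>. Confinement says that \<open>G\<close> is covered by the finitely
  many sets \<open>{g. inv g \<otimes> p \<otimes> g \<in> C}\<close> with \<open>p \<in> P\<close>. These sets are closed in the profinite topology,
  so one of them has non-empty interior (\<open>coset_in_transporter\<close>): it contains a coset \<open>a L\<close> of a
  subgroup \<open>L\<close> of finite index. Hence all \<open>L\<close>-conjugates of the non-trivial element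
  \<open>q = inv a \<otimes> p \<otimes> a\<close> lie in \<open>C\<close>, and so \<open>q\<close> lies in the intersection \<open>D\<close> of the \<open>L\<close>-conjugates of
  \<open>C\<close>. The normalizer of \<open>D\<close> contains \<open>L\<close>, hence has finite index and is just-infinite, so that its
  non-trivial normal subgroup \<open>D\<close> has finite index (\<open>finite_index_if_conjugates_mem\<close>). Thus \<open>C\<close> has
  finite index, and property (PF) gives that \<open>H\<close> itself has finite index.

  Then \<open>H\<close> has only finitely many conjugates. They form a closed invariant subset of \<open>\<U>\<close>, which by
  minimality is all of \<open>\<U>\<close>, contradicting that \<open>\<U>\<close> is infinite.\<close>

section \<open>Subgroups of finite index\<close>

context group
begin

lemma finite_index_carrier: "finite_index G (carrier G)"
proof -
  have "rcosets (carrier G) \<subseteq> {carrier G}"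
    by (auto simp: RCOSETS_def coset_join2 subgroup_self)
  then show ?thesis
    unfolding finite_index_def using subgroup_self finite_subset by blast
qed

text \<open>Each coset of \<open>B\<close> is \<open>B\<close> times a coset of \<open>A\<close>, so \<open>B\<close> has at most as many cosets as \<open>A\<close>.\<close>

lemma finite_index_mono:
  assumes "finite_index G A" "subgroup B G" "A \<subseteq> B"
  shows "finite_index G B"
proof -
  have A: "subgroup A G" "finite (rcosets A)"
    using assms(1) by (auto simp: finite_index_def)
  have "B #> x = B <#> (A #> x)" if "x \<in> carrier G" for x
  proof -
    have "B <#> A = B"
    proof
      show "B <#> A \<subseteq> B"
        using assms(2,3) by (auto simp: set_mult_def subgroup.m_closed subset_iff)
      have "b \<otimes> \<one> \<in> B <#> A" if "b \<in> B" for b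
        using that subgroup.one_closed[OF A(1)] by (auto simp: set_mult_def)
      then show "B \<subseteq> B <#> A"
        using subgroup.mem_carrier[OF assms(2)] by fastforce
    qed
    then show ?thesis
      using setmult_rcos_assoc[of B A x] subgroup.subset[OF A(1)] subgroup.subset[OF assms(2)] that
      by simp
  qed
  then have "rcosets B \<subseteq> (\<lambda>C. B <#> C) ` (rcosets A)"
    by (auto simp: RCOSETS_def)
  then show ?thesis
    using A(2) assms(2) finite_surj by (auto simp: finite_index_def)
qed

text \<open>Each coset of \<open>A \<inter> B\<close> is the intersection of a coset of \<open>A\<close> with a coset of \<open>B\<close>.\<close>

lemma finite_index_Int:
  assumes "finite_index G A" "finite_index G B"
  shows "finite_index G (A \<inter> B)"
proof -
  have AB: "subgroup A G" "finite (rcosets A)" "subgroup B G" "finite (rcosets B)"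
    using assms by (auto simp: finite_index_def)
  have "(A \<inter> B) #> x = (A #> x) \<inter> (B #> x)" if x: "x \<in> carrier G" for x
  proof -
    have "y \<in> (A \<inter> B) #> x" if "y \<in> A #> x" "y \<in> B #> x" for y
    proof -
      obtain a b where ab: "a \<in> A" "b \<in> B" "y = a \<otimes> x" "y = b \<otimes> x"
        using \<open>y \<in> A #> x\<close> \<open>y \<in> B #> x\<close> unfolding r_coset_def by blast
      then have "a = b"
        using x subgroup.mem_carrier[OF AB(1)] subgroup.mem_carrier[OF AB(3)]
        by (metis right_cancel)
      then show ?thesis
        using ab by (auto simp: r_coset_def)
    qed
    then show ?thesis
      by (auto simp: r_coset_def)
  qed
  then have "rcosets (A \<inter> B) \<subseteq> (\<lambda>(C, D). C \<inter> D) ` ((rcosets A) \<times> (rcosets B))"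
    unfolding RCOSETS_def by force
  then have "finite (rcosets (A \<inter> B))"
    by (rule finite_subset) (use AB(2,4) in blast)
  then show ?thesis
    using AB(1,3) subgroups_Inter_pair by (auto simp: finite_index_def)
qed

text \<open>Each coset of \<open>D\<close> in \<open>G\<close> is a translate of a coset of \<open>D\<close> in \<open>K\<close> by one of finitely many
  representatives of the cosets of \<open>K\<close>.\<close>

lemma finite_index_trans:
  assumes "finite_index G K" "finite_index (G\<lparr>carrier := K\<rparr>) D"
  shows "finite_index G D"
proof -
  have K: "subgroup K G" "finite (rcosets K)"
    using assms(1) by (auto simp: finite_index_def)
  have D: "subgroup D (G\<lparr>carrier := K\<rparr>)" "finite (rcosets\<^bsub>G\<lparr>carrier := K\<rparr>\<^esub> D)"
    using assms(2) by (auto simp: finite_index_def)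
  have DG: "subgroup D G"
    using incl_subgroup[OF K(1) D(1)] .
  have "rcosets K = (\<lambda>t. K #> t) ` carrier G"
    by (auto simp: RCOSETS_def)
  then obtain T where T: "T \<subseteq> carrier G" "finite T" "rcosets K = (\<lambda>t. K #> t) ` T"
    using K(2) by (metis finite_subset_image subset_refl)
  have "rcosets D \<subseteq> (\<lambda>(E, t). E #> t) ` ((rcosets\<^bsub>G\<lparr>carrier := K\<rparr>\<^esub> D) \<times> T)"
  proof
    fix C assume "C \<in> rcosets D"
    then obtain x where x: "x \<in> carrier G" "C = D #> x"
      by (auto simp: RCOSETS_def)
    have "K #> x \<in> rcosets K"
      using x(1) by (auto simp: RCOSETS_def)
    then obtain t where t: "t \<in> T" "K #> x = K #> t"
      using T(3) by auto
    have "x \<in> K #> t"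
      using rcos_self[OF x(1) K(1)] t(2) by simp
    then obtain k where k: "k \<in> K" "x = k \<otimes> t"
      by (auto simp: r_coset_def)
    have "C = (D #> k) #> t"
      using x(2) k(2) coset_mult_assoc[OF subgroup.subset[OF DG] subgroup.mem_carrier[OF K(1) k(1)]]
        t(1) T(1) by auto
    moreover have "D #> k \<in> rcosets\<^bsub>G\<lparr>carrier := K\<rparr>\<^esub> D"
      using k(1) by (auto simp: RCOSETS_def)
    ultimately show "C \<in> (\<lambda>(E, t). E #> t) ` ((rcosets\<^bsub>G\<lparr>carrier := K\<rparr>\<^esub> D) \<times> T)"
      using t(1) by auto
  qed
  then have "finite (rcosets D)"
    by (rule finite_subset) (use D(2) T(2) in blast)
  then show ?thesis
    using DG by (simp add: finite_index_def)
qed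

lemma mult_inv_cancel:
  assumes "x \<in> carrier G" "y \<in> carrier G"
  shows "x \<otimes> (inv x \<otimes> y) = y" "inv x \<otimes> (x \<otimes> y) = y"
  using assms by (simp_all flip: m_assoc)

lemma mem_conjugate_iff:
  assumes "g \<in> carrier G" "H \<subseteq> carrier G"
  shows "x \<in> g <# H #> inv g \<longleftrightarrow> x \<in> carrier G \<and> inv g \<otimes> x \<otimes> g \<in> H"
proof
  assume "x \<in> g <# H #> inv g"
  then obtain h where h: "h \<in> H" "x = g \<otimes> h \<otimes> inv g"
    by (auto simp: l_coset_def r_coset_def)
  then have "h \<in> carrier G" using assms by auto
  then show "x \<in> carrier G \<and> inv g \<otimes> x \<otimes> g \<in> H"
    using h assms(1) by (simp add: m_assoc mult_inv_cancel)
next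
  assume x: "x \<in> carrier G \<and> inv g \<otimes> x \<otimes> g \<in> H"
  have "g \<otimes> (inv g \<otimes> x \<otimes> g) \<otimes> inv g = x"
    using x assms(1) by (simp add: m_assoc mult_inv_cancel)
  then show "x \<in> g <# H #> inv g"
    using x unfolding l_coset_def r_coset_def by force
qed

lemma conj_conj:
  assumes "g \<in> carrier G" "h \<in> carrier G" "H \<subseteq> carrier G"
  shows "g <# (h <# H #> inv h) #> inv g = (g \<otimes> h) <# H #> inv (g \<otimes> h)"
proof -
  have hH: "h <# H #> inv h \<subseteq> carrier G"
    using mem_conjugate_iff assms by blast
  have "inv h \<otimes> (inv g \<otimes> x \<otimes> g) \<otimes> h = inv (g \<otimes> h) \<otimes> x \<otimes> (g \<otimes> h)" if "x \<in> carrier G" for x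
    using that assms by (simp add: inv_mult_group m_assoc)
  then show ?thesis
    using mem_conjugate_iff[OF assms(1) hH] mem_conjugate_iff[OF assms(2,3)]
      mem_conjugate_iff[OF m_closed[OF assms(1,2)] assms(3)] assms
    by (auto simp: set_eq_iff simp del: inv_mult_group)
qed

text \<open>The conjugate of \<open>H\<close> by \<open>g\<close> is determined by the right coset \<open>H #> inv g\<close>: it is the set of
  all quotients \<open>inv c \<otimes> d\<close> of two elements of that coset.\<close>

lemma finite_conjugates_if_finite_index:
  assumes "finite_index G H"
  shows "finite ((\<lambda>g. g <# H #> inv g) ` carrier G)"
proof -
  have H: "subgroup H G" "finite (rcosets H)"
    using assms by (auto simp: finite_index_def)
  have "g <# H #> inv g = {inv c \<otimes> d | c d. c \<in> H #> inv g \<and> d \<in> H #> inv g}" (is "_ = ?R")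
    if g: "g \<in> carrier G" for g
  proof
    show "g <# H #> inv g \<subseteq> ?R"
    proof
      fix x assume "x \<in> g <# H #> inv g"
      then obtain h where h: "h \<in> H" "x = g \<otimes> h \<otimes> inv g"
        by (auto simp: l_coset_def r_coset_def)
      have "x = inv (inv g) \<otimes> (h \<otimes> inv g)"
        using h g subgroup.mem_carrier[OF H(1)] by (simp add: m_assoc)
      moreover have "inv g \<in> H #> inv g"
        using rcos_self[OF _ H(1)] g by blast
      moreover have "h \<otimes> inv g \<in> H #> inv g"
        using h by (auto simp: r_coset_def)
      ultimately show "x \<in> ?R" by blast
    qed
    show "?R \<subseteq> g <# H #> inv g"
    proof clarify
      fix c d assume "c \<in> H #> inv g" "d \<in> H #> inv g"
      then obtain h k where hk: "h \<in> H" "k \<in> H" "c = h \<otimes> inv g" "d = k \<otimes> inv g"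
        by (auto simp: r_coset_def)
      have "inv c \<otimes> d = g \<otimes> (inv h \<otimes> k) \<otimes> inv g"
        using hk g subgroup.mem_carrier[OF H(1)] by (simp add: m_assoc inv_mult_group)
      moreover have "inv h \<otimes> k \<in> H"
        using hk H(1) by (simp add: subgroup.m_closed subgroup.m_inv_closed)
      ultimately show "inv c \<otimes> d \<in> g <# H #> inv g"
        by (auto simp: l_coset_def r_coset_def)
    qed
  qed
  then have "(\<lambda>g. g <# H #> inv g) ` carrier G
      \<subseteq> (\<lambda>C. {inv c \<otimes> d | c d. c \<in> C \<and> d \<in> C}) ` (rcosets H)"
    using rcosetsI[OF subgroup.subset[OF H(1)]] by fastforce
  then show ?thesis
    by (rule finite_subset) (use H(2) in blast)
qed

section \<open>The profinite closure of a subgroup\<close>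

lemma subgroup_set_mult_normal:
  assumes "subgroup H G" "N \<lhd> G"
  shows "subgroup (H <#> N) G" "H \<subseteq> H <#> N" "N \<subseteq> H <#> N"
proof -
  show "subgroup (H <#> N) G"
    using mult_norm_subgroup[OF assms(2,1)] commut_normal[OF assms] by simp
  have "\<one> \<in> H" "\<one> \<in> N" "H \<subseteq> carrier G" "N \<subseteq> carrier G"
    using assms normal_imp_subgroup subgroup.one_closed subgroup.subset by metis+
  then show "H \<subseteq> H <#> N" "N \<subseteq> H <#> N"
    unfolding set_mult_def by force+
qed

lemma carrier_normal: "carrier G \<lhd> G"
  by (simp add: normal_inv_iff subgroup_self)

lemma subgroup_profinite_closure:
  assumes "subgroup H G"
  shows "subgroup (profinite_closure G H) G"
  unfolding profinite_closure_def
  using assms subgroup_set_mult_normal(1) finite_index_carrier carrier_normal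
  by (intro subgroups_Inter) auto

lemma subset_profinite_closure:
  assumes "subgroup H G"
  shows "H \<subseteq> profinite_closure G H"
  unfolding profinite_closure_def using assms subgroup_set_mult_normal(2) by blast

text \<open>The complement of the profinite closure is open: if \<open>x\<close> is not in \<open>H <#> N\<close> then neither is
  any \<open>N\<close>-conjugate of \<open>x\<close>, as \<open>H <#> N\<close> is a subgroup that contains \<open>N\<close>. Conjugates are used instead
  of a coset of \<open>x\<close> because the sets to be shown closed are defined by conjugation.\<close>

lemma conjugates_avoid_profinite_closure:
  assumes H: "subgroup H G" and x: "x \<in> carrier G" "x \<notin> profinite_closure G H"
  obtains N where "N \<lhd> G" "finite_index G N"
    "\<And>n. n \<in> N \<Longrightarrow> inv n \<otimes> x \<otimes> n \<notin> profinite_closure G H"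
proof -
  obtain N where N: "N \<lhd> G" "finite_index G N" "x \<notin> H <#> N"
    using x(2) by (auto simp: profinite_closure_def)
  note HN = subgroup_set_mult_normal[OF H N(1)]
  have "inv n \<otimes> x \<otimes> n \<notin> H <#> N" if n: "n \<in> N" for n
  proof
    assume *: "inv n \<otimes> x \<otimes> n \<in> H <#> N"
    have nHN: "n \<in> H <#> N" and nG: "n \<in> carrier G"
      using n HN subgroup.mem_carrier[OF HN(1)] by auto
    have "n \<otimes> (inv n \<otimes> x \<otimes> n) \<otimes> inv n \<in> H <#> N"
      using * nHN HN(1) by (meson subgroup.m_closed subgroup.m_inv_closed)
    also have "n \<otimes> (inv n \<otimes> x \<otimes> n) \<otimes> inv n = x"
      using nG x(1) by (simp add: m_assoc mult_inv_cancel)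
    finally show False using N(3) by simp
  qed
  then show ?thesis
    using that[OF N(1,2)] N by (auto simp: profinite_closure_def)
qed

text \<open>If finitely many closed sets cover a non-empty open set, then one of them has non-empty
  interior. Here the closed sets are the transporters \<open>{g. inv g \<otimes> p \<otimes> g \<in> C}\<close> of the elements
  \<open>p \<in> P\<close> into the profinite closure \<open>C\<close> of \<open>H\<close>, and the open set is the coset of \<open>M\<close> at \<open>g\<close>. If the
  transporter of \<open>p\<close> does not contain that coset, then it misses a smaller one, which is covered by
  the transporters of the other elements; so induction on \<open>P\<close> applies, and \<open>g\<close> and \<open>M\<close> have to vary
  in it.\<close>

lemma coset_in_transporter:
  assumes H: "subgroup H G"
    and P: "finite P" "P \<subseteq> carrier G"
    and g: "g \<in> carrier G" and M: "M \<lhd> G" "finite_index G M"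
    and cover: "\<And>m. m \<in> M \<Longrightarrow>
      \<exists>p\<in>P. inv (g \<otimes> m) \<otimes> p \<otimes> (g \<otimes> m) \<in> profinite_closure G H"
  shows "\<exists>p\<in>P. \<exists>a\<in>carrier G. \<exists>L. finite_index G L \<and>
    (\<forall>m\<in>L. inv (a \<otimes> m) \<otimes> p \<otimes> (a \<otimes> m) \<in> profinite_closure G H)"
  using P g M cover
proof (induction P arbitrary: g M rule: finite_induct)
  case empty
  then show ?case
    using subgroup.one_closed[OF normal_imp_subgroup[OF empty.prems(3)]] by blast
next
  case (insert p P)
  let ?C = "profinite_closure G H"
  show ?case
  proof (cases "\<forall>m\<in>M. inv (g \<otimes> m) \<otimes> p \<otimes> (g \<otimes> m) \<in> ?C")
    case True
    then show ?thesis using insert.prems by blast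
  next
    case False
    then obtain m where m: "m \<in> M" "inv (g \<otimes> m) \<otimes> p \<otimes> (g \<otimes> m) \<notin> ?C"
      by blast
    have p: "p \<in> carrier G" and PG: "P \<subseteq> carrier G"
      using insert.prems(1) by auto
    have subM: "subgroup M G"
      using insert.prems(3) by (rule normal_imp_subgroup)
    have mG: "m \<in> carrier G"
      using m(1) subgroup.mem_carrier[OF subM] by blast
    let ?x = "inv (g \<otimes> m) \<otimes> p \<otimes> (g \<otimes> m)"
    have "?x \<in> carrier G"
      using p mG insert.prems(2) by simp
    then obtain N where N: "N \<lhd> G" "finite_index G N" "\<And>n. n \<in> N \<Longrightarrow> inv n \<otimes> ?x \<otimes> n \<notin> ?C"
      using conjugates_avoid_profinite_closure[OF H _ m(2)] by blast
    have "\<exists>q\<in>P. inv (g \<otimes> m \<otimes> n) \<otimes> q \<otimes> (g \<otimes> m \<otimes> n) \<in> ?C" if n: "n \<in> M \<inter> N" for n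
    proof -
      have nG: "n \<in> carrier G"
        using n subgroup.mem_carrier[OF subM] by blast
      have eq: "g \<otimes> m \<otimes> n = g \<otimes> (m \<otimes> n)"
        using nG mG insert.prems(2) by (simp add: m_assoc)
      have "m \<otimes> n \<in> M"
        using subgroup.m_closed[OF subM m(1)] n by blast
      then obtain q where q: "q \<in> insert p P" "inv (g \<otimes> m \<otimes> n) \<otimes> q \<otimes> (g \<otimes> m \<otimes> n) \<in> ?C"
        using insert.prems(5) eq by auto
      have "inv (g \<otimes> m \<otimes> n) \<otimes> p \<otimes> (g \<otimes> m \<otimes> n) = inv n \<otimes> ?x \<otimes> n"
        using nG mG p insert.prems(2) by (simp add: m_assoc inv_mult_group)
      \<comment> \<open>By the choice of \<open>N\<close> the new coset \<open>g m (M \<inter> N)\<close> misses the transporter of \<open>p\<close>.\<close>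
      then have "q \<noteq> p"
        using q(2) N(3) n by auto
      then show ?thesis using q by blast
    qed
    then have "\<exists>q\<in>P. \<exists>a\<in>carrier G. \<exists>L. finite_index G L \<and>
        (\<forall>l\<in>L. inv (a \<otimes> l) \<otimes> q \<otimes> (a \<otimes> l) \<in> ?C)"
      using insert.IH[OF PG _ normal_subgroup_intersect[OF insert.prems(3) N(1)]
          finite_index_Int[OF insert.prems(4) N(2)]] insert.prems(2) mG by blast
    then show ?thesis by blast
  qed
qed

section \<open>Subgroups of hereditarily just-infinite groups\<close>

text \<open>Let \<open>D\<close> be the intersection of the \<open>M\<close>-conjugates of \<open>C\<close>. It is a non-trivial normal subgroup of
  its normalizer, which is just-infinite because it contains \<open>M\<close> and so has finite index. Passing to
  the normalizer of \<open>D\<close>, and not just to \<open>M\<close>, is what makes the argument work when \<open>q\<close> lies outside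
  \<open>M\<close>, in which case \<open>D \<inter> M\<close> might be trivial.\<close>

lemma finite_index_if_conjugates_mem:
  assumes hji: "hereditarily_just_infinite G"
    and C: "subgroup C G" and M: "finite_index G M"
    and q: "q \<in> carrier G" "q \<noteq> \<one>"
    and conj: "\<And>m. m \<in> M \<Longrightarrow> inv m \<otimes> q \<otimes> m \<in> C"
  shows "finite_index G C"
proof -
  define D where "D = (\<Inter>m\<in>M. m <# C #> inv m)"
  have subM: "subgroup M G"
    using M by (simp add: finite_index_def)
  have MG: "m \<in> carrier G" if "m \<in> M" for m
    using that subgroup.mem_carrier[OF subM] by blast
  have one: "\<one> \<in> M"
    using subM by (rule subgroup.one_closed)
  have CG: "C \<subseteq> carrier G"
    using C by (rule subgroup.subset)
  have D_iff: "x \<in> D \<longleftrightarrow> x \<in> carrier G \<and> (\<forall>m\<in>M. inv m \<otimes> x \<otimes> m \<in> C)" for x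
    unfolding D_def using mem_conjugate_iff[OF MG CG] one by auto
  have D: "subgroup D G"
    unfolding D_def using one subgroup_conjugation_is_surj2[OF MG C]
    by (intro subgroups_Inter) auto
  have DG: "D \<subseteq> carrier G"
    using D by (rule subgroup.subset)
  have DC: "D \<subseteq> C"
    using D_iff one by fastforce
  have qD: "q \<in> D"
    using D_iff q conj by blast
  have D_conj: "m <# D #> inv m = D" if m: "m \<in> M" for m
  proof -
    have *: "inv m \<otimes> x \<otimes> m \<in> D" if m: "m \<in> M" and x: "x \<in> D" for m x
    proof -
      have xG: "x \<in> carrier G"
        using x DG by blast
      have "inv k \<otimes> (inv m \<otimes> x \<otimes> m) \<otimes> k \<in> C" if k: "k \<in> M" for k
      proof -
        have "inv k \<otimes> (inv m \<otimes> x \<otimes> m) \<otimes> k = inv (m \<otimes> k) \<otimes> x \<otimes> (m \<otimes> k)"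
          using MG[OF k] MG[OF m] xG by (simp add: m_assoc inv_mult_group)
        moreover have "m \<otimes> k \<in> M"
          using m k subM by (simp add: subgroup.m_closed)
        ultimately show ?thesis
          using x D_iff by auto
      qed
      then show ?thesis
        using D_iff xG MG[OF m] by simp
    qed
    have "x \<in> D" if x: "x \<in> carrier G" "inv m \<otimes> x \<otimes> m \<in> D" for x
    proof -
      have "inv (inv m) \<otimes> (inv m \<otimes> x \<otimes> m) \<otimes> inv m \<in> D"
        using * x(2) m subM by (simp add: subgroup.m_inv_closed)
      also have "inv (inv m) \<otimes> (inv m \<otimes> x \<otimes> m) \<otimes> inv m = x"
        using MG[OF m] x(1) by (simp add: m_assoc mult_inv_cancel)
      finally show ?thesis .
    qed
    then show ?thesis
      using mem_conjugate_iff[OF MG[OF m] DG] *[OF m] DG by blast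
  qed
  define K where "K = normalizer G D"
  have K: "subgroup K G" and DK: "D \<lhd> G\<lparr>carrier := K\<rparr>"
    unfolding K_def using normalizer_imp_subgroup[OF DG] subgroup_in_normalizer[OF D] by auto
  have "M \<subseteq> K"
    unfolding K_def normalizer_def stabilizer_def using D_conj MG DG by auto
  then have fiK: "finite_index G K"
    using finite_index_mono[OF M K] by simp
  moreover have "D \<noteq> {\<one>\<^bsub>G\<lparr>carrier := K\<rparr>\<^esub>}"
    using qD q(2) by auto
  ultimately have "finite (carrier (G\<lparr>carrier := K\<rparr> Mod D))"
    using hji DK unfolding hereditarily_just_infinite_def just_infinite_def by blast
  then have "finite_index (G\<lparr>carrier := K\<rparr>) D"
    using normal_imp_subgroup[OF DK] by (simp add: finite_index_def FactGroup_def)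
  then have "finite_index G D"
    using finite_index_trans[OF fiK] by simp
  then show ?thesis
    using finite_index_mono C DC by blast
qed

lemma finite_index_profinite_closure_if_confined:
  assumes hji: "hereditarily_just_infinite G" and H: "subgroup H G"
    and P: "finite P" "P \<subseteq> carrier G - {\<one>}"
    and confined: "\<And>g. g \<in> carrier G \<Longrightarrow> (g <# H #> inv g) \<inter> P \<noteq> {}"
  shows "finite_index G (profinite_closure G H)"
proof -
  let ?C = "profinite_closure G H"
  have "\<exists>p\<in>P. inv (\<one> \<otimes> m) \<otimes> p \<otimes> (\<one> \<otimes> m) \<in> ?C" if m: "m \<in> carrier G" for m
    using confined[OF m] mem_conjugate_iff[OF m subgroup.subset[OF H]] subset_profinite_closure[OF H] m
    by auto
  then obtain p a L where p: "p \<in> P" and a: "a \<in> carrier G" and L: "finite_index G L"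
    and mem: "\<And>m. m \<in> L \<Longrightarrow> inv (a \<otimes> m) \<otimes> p \<otimes> (a \<otimes> m) \<in> ?C"
    using coset_in_transporter[OF H P(1) _ one_closed carrier_normal finite_index_carrier] P(2)
    by blast
  have pG: "p \<in> carrier G" "p \<noteq> \<one>"
    using p P(2) by auto
  have "inv m \<otimes> (inv a \<otimes> p \<otimes> a) \<otimes> m \<in> ?C" if m: "m \<in> L" for m
  proof -
    have "m \<in> carrier G"
      using m L subgroup.mem_carrier by (auto simp: finite_index_def)
    then show ?thesis
      using mem[OF m] a pG by (simp add: m_assoc inv_mult_group)
  qed
  moreover have "inv a \<otimes> p \<otimes> a \<noteq> \<one>"
  proof
    assume "inv a \<otimes> p \<otimes> a = \<one>"
    then have "a \<otimes> (inv a \<otimes> p \<otimes> a) \<otimes> inv a = \<one>"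
      using a by simp
    then show False
      using a pG by (simp add: m_assoc mult_inv_cancel)
  qed
  ultimately show ?thesis
    using finite_index_if_conjugates_mem[OF hji subgroup_profinite_closure[OF H] L,
      of "inv a \<otimes> p \<otimes> a"] a pG by blast
qed

end

section \<open>The space of subgroups\<close>

lemma openin_Sub_topology_mem:
  fixes G (structure)
  assumes "x \<in> carrier G"
  shows "openin (Sub_topology G) {H. subgroup H G \<and> (x \<in> H \<longleftrightarrow> b)}"
proof -
  let ?X = "product_topology (\<lambda>_. discrete_topology (UNIV :: bool set)) (carrier G)"
  have "openin ?X {f \<in> topspace ?X. f x \<in> {b}}"
    using assms by (intro openin_continuous_map_preimage[OF continuous_map_product_projection]) auto
  then show ?thesis
    unfolding Sub_topology_def openin_pullback_topology
    using assms by (intro exI[of _ "{f \<in> topspace ?X. f x \<in> {b}}"]) auto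
qed

text \<open>Points are closed: a subgroup different from \<open>H\<close> differs from it at some \<open>x\<close>, and membership of
  \<open>x\<close> is a clopen condition.\<close>

lemma closedin_Sub_topology_finite:
  fixes G (structure)
  assumes "finite \<U>" "\<And>H. H \<in> \<U> \<Longrightarrow> subgroup H G"
  shows "closedin (Sub_topology G) \<U>"
proof -
  have "closedin (Sub_topology G) {H}" if H: "subgroup H G" for H
  proof -
    have "topspace (Sub_topology G) - {H}
        = (\<Union>x\<in>carrier G. {K. subgroup K G \<and> (x \<in> K \<longleftrightarrow> x \<notin> H)})"
      using H by (auto simp: topspace_Sub_topology dest: subgroup.mem_carrier)
    then have "openin (Sub_topology G) (topspace (Sub_topology G) - {H})"
      by (auto intro: openin_Sub_topology_mem)
    then show ?thesis
      using H by (simp add: closedin_def topspace_Sub_topology)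
  qed
  then have "closedin (Sub_topology G) (\<Union>H\<in>\<U>. {H})"
    using assms by (intro closedin_Union) auto
  then show ?thesis by simp
qed

text \<open>A basic neighbourhood of the trivial subgroup prescribes membership of finitely many elements
  only. So if it is disjoint from \<open>\<U>\<close>, every member of \<open>\<U>\<close> contains one of the non-trivial elements
  among these.\<close>

lemma (in group) meets_finite_set_if_trivial_notin_closed:
  assumes U: "closedin (Sub_topology G) \<U>" "{\<one>} \<notin> \<U>"
  obtains P where "finite P" "P \<subseteq> carrier G - {\<one>}" "\<And>K. K \<in> \<U> \<Longrightarrow> K \<inter> P \<noteq> {}"
proof -
  let ?f = "\<lambda>H. \<lambda>x\<in>carrier G. x \<in> H"
  let ?X = "product_topology (\<lambda>_. discrete_topology (UNIV :: bool set)) (carrier G)"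
  have "openin (Sub_topology G) ({H. subgroup H G} - \<U>)"
    using U(1) by (simp add: closedin_def topspace_Sub_topology)
  then obtain W where W: "openin ?X W" "{H. subgroup H G} - \<U> = ?f -` W \<inter> {H. subgroup H G}"
    unfolding Sub_topology_def openin_pullback_topology by blast
  have "{\<one>} \<in> {H. subgroup H G} - \<U>"
    using U(2) triv_subgroup by blast
  then have "?f {\<one>} \<in> W"
    using W(2) by blast
  then obtain B where B: "finite {i \<in> carrier G. B i \<noteq> UNIV}"
      "?f {\<one>} \<in> Pi\<^sub>E (carrier G) B" "Pi\<^sub>E (carrier G) B \<subseteq> W"
    using W(1) unfolding openin_product_topology_alt topspace_discrete_topology by blast
  define P where "P = {i \<in> carrier G. B i \<noteq> UNIV} - {\<one>}"
  have "K \<inter> P \<noteq> {}" if K: "K \<in> \<U>" for K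
  proof
    assume disj: "K \<inter> P = {}"
    have subK: "subgroup K G"
      using closedin_subset[OF U(1)] K by (auto simp: topspace_Sub_topology)
    have "?f K \<in> Pi\<^sub>E (carrier G) B"
    proof (rule PiE_I)
      fix i assume i: "i \<in> carrier G"
      show "?f K i \<in> B i"
      proof (cases "B i = UNIV")
        case False
        then have "i \<in> K \<longleftrightarrow> i \<in> {\<one>}"
          using disj i subgroup.one_closed[OF subK] by (auto simp: P_def)
        then show ?thesis
          using PiE_mem[OF B(2) i] i by simp
      qed simp
    qed simp
    then show False
      using W(2) B(3) subK K by blast
  qed
  then show ?thesis
    using that[of P] B(1) by (auto simp: P_def)
qed

text \<open>The conjugacy class of \<open>H\<close> is finite, hence closed, so by minimality it is the whole URS.\<close>

lemma (in group) URS_finite_if_finite_index_mem: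
  assumes U: "URS G \<U>" and H: "H \<in> \<U>" "finite_index G H"
  shows "finite \<U>"
proof -
  let ?O = "(\<lambda>g. g <# H #> inv g) ` carrier G"
  have subH: "subgroup H G"
    using H(2) by (simp add: finite_index_def)
  have fin: "finite ?O"
    using finite_conjugates_if_finite_index[OF H(2)] .
  have "?O \<subseteq> \<U>"
    using U H(1) by (auto simp: URS_def conj_invariant_def)
  moreover have "closedin (Sub_topology G) ?O"
    using closedin_Sub_topology_finite[OF fin] subgroup_conjugation_is_surj2 subH by auto
  moreover have "conj_invariant G ?O"
    using conj_conj subgroup.subset[OF subH] by (auto simp: conj_invariant_def)
  moreover have "?O \<noteq> {}"
    using one_closed by blast
  ultimately have "?O = \<U>"
    using U unfolding URS_def by blast
  then show ?thesis using fin by simp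
qed

theorem corollary4p20:
  fixes G (structure)
  assumes "group G"
    and "hereditarily_just_infinite G"
    and "property_PF G"
  shows "\<nexists>\<U>. continuous_URS G \<U>"
proof
  interpret group G by fact
  assume "\<exists>\<U>. continuous_URS G \<U>"
  then obtain \<U> where U: "URS G \<U>" and inf: "infinite \<U>"
    by (auto simp: continuous_URS_def)
  have closed: "closedin (Sub_topology G) \<U>" and inv: "conj_invariant G \<U>" and "\<U> \<noteq> {}"
    using U by (auto simp: URS_def)
  then obtain H where H: "H \<in> \<U>"
    by blast
  have subH: "subgroup H G"
    using closedin_subset[OF closed] H by (auto simp: topspace_Sub_topology)
  have "{\<one>} \<notin> \<U>"
  proof
    assume triv: "{\<one>} \<in> \<U>"
    have "g <# {\<one>} #> inv g = {\<one>}" if "g \<in> carrier G" for g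
      using that by (auto simp: l_coset_def r_coset_def)
    then have "conj_invariant G {{\<one>}}"
      by (simp add: conj_invariant_def)
    moreover have "closedin (Sub_topology G) {{\<one>}}"
      using closedin_Sub_topology_finite[of "{{\<one>}}" G] triv_subgroup by blast
    ultimately have "{{\<one>}} = \<U>"
      using U triv unfolding URS_def by blast
    then show False using inf by auto
  qed
  then obtain P where P: "finite P" "P \<subseteq> carrier G - {\<one>}" "\<And>K. K \<in> \<U> \<Longrightarrow> K \<inter> P \<noteq> {}"
    using meets_finite_set_if_trivial_notin_closed[OF closed] by blast
  have "(g <# H #> inv g) \<inter> P \<noteq> {}" if "g \<in> carrier G" for g
    using P(3) inv H that by (auto simp: conj_invariant_def)
  then have "finite_index G (profinite_closure G H)"
    using finite_index_profinite_closure_if_confined[OF assms(2) subH P(1,2)] by blast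
  then have "finite_index G H"
    using assms(3) subH by (auto simp: property_PF_def cofinitely_dense_def)
  then show False
    using URS_finite_if_finite_index_mem[OF U H] inf by blast
qed

end
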